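(* Let $m>n\ge 1$, $A\in\mathbb{R}^{m\times n}$, $b\in\mathbb{R}^m$ satisfy $0<\sigma_{n+1}<\hat\sigma_n$, and let $x$ be the TLS solution. Then $\underline{\kappa}_2\le\kappa_g(A,b)\le\bar{\kappa}_1$, where $$\underline{\kappa}_2=\frac{\sqrt{1+\|x\|^2}}{\sqrt{\hat\sigma_n^2-\sigma_{n+1}^2}},\qquad \bar{\kappa}_1=\frac{\sqrt{1+\|x\|^2}\,\sqrt{\hat\sigma_{n}^2+\sigma_{n+1}^2}}{\hat\sigma_{n}^2-\sigma_{n+1}^2}.$$ Moreover, when $n\ge 2$ and $\hat\sigma_{n-1}\ge\sigma_{n+1}+\sqrt{\hat\sigma_n^2-\sigma_{n+1}^2}$, we have $\underline{\kappa}_1\le\underline{\kappa}_2$, where $$\underline{\kappa}_1=\frac{\sqrt{1+\|x\|^2}\,\sqrt{\hat\sigma_{n-1}^2+\sigma_{n+1}^2}}{\hat\sigma_{n-1}^2-\sigma_{n+1}^2}.$$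
   Context: $\|\cdot\|$ is the Euclidean norm for vectors and the spectral norm for matrices; $\|\cdot\|_F$ is the Frobenius norm. $\hat\sigma_1\ge\cdots\ge\hat\sigma_n$ are the singular values of $A$ and $\sigma_1\ge\cdots\ge\sigma_{n+1}$ are the singular values of $[A\ \,b]\in\mathbb{R}^{m\times(n+1)}$. The total least squares (TLS) problem is $\min\|[E\ \,r]\|_F$ subject to $b-r\in\mathcal{R}(A+E)$ ($\mathcal R$ = range); under $\sigma_{n+1}<\hat\sigma_n$ its unique solution is $x=(A^TA-\sigma_{n+1}^2I_n)^{-1}A^Tb$. Absolute condition number: for $(\tilde A,\tilde b)$ in a small neighbourhood of $(A,b)$, let $\tilde\sigma_{n+1}$ be the smallest singular value of $[\tilde A\ \,\tilde b]$ and let $g:\mathbb{R}^{m(n+1)}\to\mathbb{R}^n$ be the map $[\mathrm{vec}(\tilde A)^T,\tilde b^T]^T\mapsto(\tilde A^T\tilde A-\tilde\sigma_{n+1}^2I_n)^{-1}\tilde A^T\tilde b$, i.e. the TLS solution map, where $\mathrm{vec}$ stacks columns. Then $\kappa_g(A,b):=\|g'([\mathrm{vec}(A)^T,b^T]^T)\|$, the spectral norm of the derivative of $g$ at $(A,b)$. *)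

theory Defs
  imports "HOL-Analysis.Analysis"
begin

definition gram_eigenspace :: "real^'n^'m \<Rightarrow> real \<Rightarrow> (real^'n) set" where
  "gram_eigenspace A \<mu> = {v. (transpose A ** A) *v v = \<mu> *\<^sub>R v}"

text \<open>
  Singular values: the nonnegative square roots of the eigenvalues of \<open>A\<^sup>T A\<close>, in decreasing order
  and repeated according to multiplicity. The matrix \<open>A\<^sup>T A\<close> is symmetric, so the multiplicity of
  an eigenvalue is the dimension of its eigenspace and the list has \<open>CARD('n)\<close> entries. If \<open>A\<close> has
  \<open>m < n\<close> rows, the list therefore contains \<open>n - m\<close> zeros beyond the usual \<open>min m n\<close> values.
\<close>

definition sing_values :: "real^'n^'m \<Rightarrow> real list" where
  "sing_values A =
     concat (map (\<lambda>s. replicate (dim (gram_eigenspace A (s\<^sup>2))) s)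
       (rev (sorted_list_of_set {s. 0 \<le> s \<and> gram_eigenspace A (s\<^sup>2) \<noteq> {0}})))"

text \<open>The index \<open>k\<close> is 1-based: \<open>sing_value A 1\<close> is the largest singular value.\<close>

definition sing_value :: "real^'n^'m \<Rightarrow> nat \<Rightarrow> real" where
  "sing_value A k = sing_values A ! (k - 1)"

text \<open>The matrix \<open>[A b]\<close>; the index \<open>None\<close> stands for its last column.\<close>

definition augment :: "real^'n^'m \<Rightarrow> real^'m \<Rightarrow> real^('n option)^'m" where
  "augment A b = (\<chi> i j. case j of Some k \<Rightarrow> A $ i $ k | None \<Rightarrow> b $ i)"

definition tls_feasible :: "real^'n^'m \<Rightarrow> real^'m \<Rightarrow> real^'n^'m \<Rightarrow> real^'m \<Rightarrow> bool" where
  "tls_feasible A b E r \<longleftrightarrow> b - r \<in> range (\<lambda>y. (A + E) *v y)"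

text \<open>The library's \<open>norm\<close> on \<open>real^'k^'m\<close> is the Frobenius norm.\<close>

definition tls_minimizer :: "real^'n^'m \<Rightarrow> real^'m \<Rightarrow> real^'n^'m \<Rightarrow> real^'m \<Rightarrow> bool" where
  "tls_minimizer A b E r \<longleftrightarrow>
     tls_feasible A b E r \<and>
     (\<forall>E' r'. tls_feasible A b E' r' \<longrightarrow> norm (augment E r) \<le> norm (augment E' r'))"

definition tls_solution :: "real^'n^'m \<Rightarrow> real^'m \<Rightarrow> real^'n \<Rightarrow> bool" where
  "tls_solution A b x \<longleftrightarrow> (\<exists>E r. tls_minimizer A b E r \<and> (A + E) *v x = b - r)"

text \<open>
  The vector \<open>[vec(A)\<^sup>T, b\<^sup>T]\<^sup>T\<close>. The entry of \<open>A\<close> in row \<open>i\<close> and column \<open>j\<close> is stored at \<open>Inl (j, i)\<close>,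
  and the \<open>i\<close>-th entry of \<open>b\<close> at \<open>Inr i\<close>.
\<close>

definition stack_data :: "real^'n^'m \<Rightarrow> real^'m \<Rightarrow> real^(('n \<times> 'm) + 'm)" where
  "stack_data A b = (\<chi> k. case k of Inl (j, i) \<Rightarrow> A $ i $ j | Inr i \<Rightarrow> b $ i)"

definition data_matrix :: "real^(('n::finite \<times> 'm::finite) + 'm) \<Rightarrow> real^'n^'m" where
  "data_matrix p = (\<chi> i j. p $ Inl (j, i))"

definition data_rhs :: "real^(('n::finite \<times> 'm::finite) + 'm) \<Rightarrow> real^'m" where
  "data_rhs p = (\<chi> i. p $ Inr i)"

lemma data_matrix_stack [simp]: "data_matrix (stack_data A b) = A"
  by (simp add: data_matrix_def stack_data_def vec_eq_iff)

lemma data_rhs_stack [simp]: "data_rhs (stack_data A b) = b"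
  by (simp add: data_rhs_def stack_data_def vec_eq_iff)

definition tls_map :: "real^(('n::finite \<times> 'm::finite) + 'm) \<Rightarrow> real^'n" where
  "tls_map p =
     (let A = data_matrix p; b = data_rhs p; s = sing_value (augment A b) (CARD('n) + 1)
      in matrix_inv (transpose A ** A - s\<^sup>2 *\<^sub>R mat 1) *v (transpose A *v b))"

text \<open>
  The operator norm with respect to the Euclidean norms is the spectral norm of the Jacobian matrix.
\<close>

definition tls_cond :: "real^'n^'m \<Rightarrow> real^'m \<Rightarrow> real" where
  "tls_cond A b =
     onorm (frechet_derivative (tls_map :: real^(('n \<times> 'm) + 'm) \<Rightarrow> real^'n) (at (stack_data A b)))"

end

(*
  Write l for the square of the smallest singular value of [A b], r = A x - b, q = 1 + |x|^2 and
  M = A^T A - l I.  The TLS solution is the x for which (x, -1) is an eigenvector of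
  [A b]^T [A b] for l, that is, A^T r = l x and b . r = -l; hence |r|^2 = l q.  Subtracting these
  equations at two data points gives exact formulas for the increments of l and x, which yield
  differentiability and the derivative in direction (dA, db) with u = dA x - db:
    dx = - M^(-1) (dA^T r + A^T H u),   where H is the reflection in the hyperplane orthogonal to r.
  Pairing dx with M w exhibits the adjoint, whose value at M w has squared norm
    q (l |w|^2 + |A w|^2) - 2 l (x . w)^2.
  Dropping the last term gives the upper bound, since M is at least m = sh_n^2 - l (sh_n being the
  smallest singular value of A) and l |w|^2 + |A w|^2 = w . M w + 2 l |w|^2.  For the lower bound,
  take w to be an eigenvector of A^T A for sh_n^2 and use (x . w)^2 <= q |w|^2.
*)
theory Submission
  imports Defs
begin

section \<open>The smallest singular value\<close>

lemma inner_matrix_transpose: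
  fixes A :: "real^'n^'m"
  shows "(A *v x) \<bullet> y = x \<bullet> (transpose A *v y)"
  by (metis dot_lmul_matrix inner_commute vector_transpose_matrix)

lemma inner_gram:
  fixes A :: "real^'n^'m"
  shows "x \<bullet> ((transpose A ** A) *v y) = (A *v x) \<bullet> (A *v y)"
  by (simp add: inner_matrix_transpose flip: matrix_vector_mul_assoc)

lemma subspace_gram_eigenspace: "subspace (gram_eigenspace A \<mu>)"
  by (auto simp: subspace_def gram_eigenspace_def matrix_vector_right_distrib
      scaleR_right_distrib matrix_vector_mult_scaleR)

lemma gram_eigenspace_norm:
  assumes "v \<in> gram_eigenspace A \<mu>"
  shows "(norm (A *v v))\<^sup>2 = \<mu> * (norm v)\<^sup>2"
  using assms inner_gram[of v A v] by (simp add: gram_eigenspace_def power2_norm_eq_inner)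

lemma gram_eigenspace_orthogonal:
  assumes "v \<in> gram_eigenspace A \<mu>" "w \<in> gram_eigenspace A \<nu>" "\<mu> \<noteq> \<nu>"
  shows "orthogonal v w"
proof -
  have "\<nu> * (v \<bullet> w) = \<mu> * (v \<bullet> w)"
    using inner_gram[of v A w] inner_gram[of w A v] assms
    by (simp add: gram_eigenspace_def inner_commute)
  then show ?thesis using assms(3) by (simp add: orthogonal_def)
qed

text \<open>A minimiser of the Rayleigh quotient on an invariant subspace is an eigenvector.\<close>

lemma gram_eigenvector_minimal:
  fixes A :: "real^'n^'m"
  assumes W: "subspace W" "W \<noteq> {0}"
    and inv: "\<And>w. w \<in> W \<Longrightarrow> (transpose A ** A) *v w \<in> W"
  obtains v s where "v \<in> W" "norm v = 1" "0 \<le> s" "v \<in> gram_eigenspace A (s\<^sup>2)"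
    "\<And>w. w \<in> W \<Longrightarrow> s * norm w \<le> norm (A *v w)"
proof -
  let ?K = "W \<inter> sphere 0 1"
  obtain w0 where w0: "w0 \<in> W" "w0 \<noteq> 0"
    using W subspace_0 by blast
  have "w0 /\<^sub>R norm w0 \<in> ?K"
    using w0 W by (auto simp: subspace_scale)
  then have ne: "?K \<noteq> {}" by blast
  have "compact ?K"
    using closed_subspace[OF W(1)] by (simp add: closed_Int_compact)
  moreover have "continuous_on ?K (\<lambda>w. norm (A *v w))"
    by (intro continuous_intros matrix_vector_mult_linear_continuous_on)
  ultimately obtain v where v: "v \<in> ?K" and min: "\<And>w. w \<in> ?K \<Longrightarrow> norm (A *v v) \<le> norm (A *v w)"
    using continuous_attains_inf[OF _ ne] by metis
  define s where "s = norm (A *v v)"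
  have le: "s * norm w \<le> norm (A *v w)" if "w \<in> W" for w
  proof (cases "w = 0")
    case False
    then have "s \<le> norm (A *v (w /\<^sub>R norm w))"
      using that W unfolding s_def by (intro min) (auto simp: subspace_scale)
    then show ?thesis using False by (simp add: matrix_vector_mult_scaleR field_simps)
  qed simp
  \<comment> \<open>\<open>2 u\<close> is the gradient of \<open>|A w|^2 - s^2 |w|^2\<close> at
    \<open>v\<close>. This function is nonnegative on \<open>W\<close> and zero at \<open>v\<close>,
    so comparing \<open>v\<close> with \<open>v - t u\<close> forces \<open>u = 0\<close>.\<close>
  define u where "u = (transpose A ** A) *v v - s\<^sup>2 *\<^sub>R v"
  have uW: "u \<in> W"
    using v W inv by (auto simp: u_def intro!: subspace_diff subspace_scale)
  define G where "G = (norm (A *v u))\<^sup>2 - s\<^sup>2 * (norm u)\<^sup>2"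
  have key: "0 \<le> t * t * G - 2 * t * (u \<bullet> u)" for t
  proof -
    have "v - t *\<^sub>R u \<in> W" using v uW W by (auto intro!: subspace_diff subspace_scale)
    then have "(s * norm (v - t *\<^sub>R u))\<^sup>2 \<le> (norm (A *v (v - t *\<^sub>R u)))\<^sup>2"
      by (intro power_mono le) (auto simp: s_def)
    moreover have "(A *v v) \<bullet> (A *v u) - s\<^sup>2 * (v \<bullet> u) = u \<bullet> u"
    proof -
      have "u \<bullet> u = u \<bullet> ((transpose A ** A) *v v - s\<^sup>2 *\<^sub>R v)" by (simp add: u_def)
      then show ?thesis by (simp add: inner_diff_right inner_gram inner_commute)
    qed
    moreover have "(norm (A *v v))\<^sup>2 = s\<^sup>2 * (norm v)\<^sup>2" using v by (simp add: s_def)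
    ultimately show ?thesis
      unfolding G_def power_mult_distrib power2_norm_eq_inner
      by (simp add: matrix_vector_mult_diff_distrib matrix_vector_mult_scaleR inner_diff
          inner_commute algebra_simps)
  qed
  have "G \<ge> 0"
    using power_mono[OF le[OF uW], of 2] by (simp add: G_def power_mult_distrib s_def)
  have "u \<bullet> u = 0"
  proof (rule ccontr)
    assume nz: "u \<bullet> u \<noteq> 0"
    define a where "a = u \<bullet> u"
    have "a > 0" using nz by (simp add: a_def)
    \<comment> \<open>The value \<open>t = a / (G + 1)\<close> satisfies \<open>t * G < a\<close>,
      which makes the quadratic in \<open>key\<close> negative; the summand 1 covers
      \<open>G = 0\<close>.\<close>
    have "0 \<le> (a / (G + 1)) * (a / (G + 1) * G - 2 * a)"
      using key[of "a / (G + 1)"] by (simp add: a_def algebra_simps)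
    moreover have "a / (G + 1) > 0" using \<open>a > 0\<close> \<open>G \<ge> 0\<close> by simp
    ultimately have "2 * a \<le> a / (G + 1) * G" unfolding zero_le_mult_iff by linarith
    then have "G * a + 2 * a \<le> 0" using \<open>G \<ge> 0\<close> by (simp add: field_simps)
    moreover have "0 \<le> G * a" using \<open>a > 0\<close> \<open>G \<ge> 0\<close> by simp
    ultimately show False using \<open>a > 0\<close> by linarith
  qed
  then have "v \<in> gram_eigenspace A (s\<^sup>2)" by (simp add: u_def gram_eigenspace_def)
  moreover have "v \<in> W" "norm v = 1" "0 \<le> s" using v by (auto simp: s_def)
  ultimately show thesis using le that by blast
qed

definition sing_value_set :: "real^'n^'m \<Rightarrow> real set" where
  "sing_value_set A = {s. 0 \<le> s \<and> gram_eigenspace A (s\<^sup>2) \<noteq> {0}}"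

text \<open>The spectral theorem for A^T A in counting form. Orthogonal bases of the eigenspaces
  together form an independent set; its orthogonal complement is invariant, so if it were nonzero it
  would contain a further eigenvector.\<close>

lemma sum_dim_gram_eigenspace:
  fixes A :: "real^'n^'m"
  shows "finite (sing_value_set A)"
    and "(\<Sum>s\<in>sing_value_set A. dim (gram_eigenspace A (s\<^sup>2))) = CARD('n)"
proof -
  let ?S = "sing_value_set A"
  have "\<exists>B. B \<subseteq> gram_eigenspace A (s\<^sup>2) \<and> pairwise orthogonal B \<and> 0 \<notin> B \<and>
      card B = dim (gram_eigenspace A (s\<^sup>2)) \<and> span B = gram_eigenspace A (s\<^sup>2)" for s
    by (rule orthonormal_basis_subspace[OF subspace_gram_eigenspace[of A "s\<^sup>2"]])
      (metis norm_zero zero_neq_one)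
  then obtain B where B: "\<And>s. B s \<subseteq> gram_eigenspace A (s\<^sup>2)" "\<And>s. pairwise orthogonal (B s)"
    "\<And>s. 0 \<notin> B s" "\<And>s. card (B s) = dim (gram_eigenspace A (s\<^sup>2))"
    "\<And>s. span (B s) = gram_eigenspace A (s\<^sup>2)" by metis
  let ?U = "\<Union>s\<in>?S. B s"
  have orth: "orthogonal v w"
    if "s \<in> ?S" "t \<in> ?S" "s \<noteq> t" "v \<in> B s" "w \<in> B t" for s t v w
    using that B(1) by (intro gram_eigenspace_orthogonal[of v A "s\<^sup>2" w "t\<^sup>2"])
      (auto simp: sing_value_set_def)
  have "pairwise orthogonal ?U"
    using orth B(2) unfolding pairwise_def by blast
  then have ind: "independent ?U" using B(3) by (intro pairwise_orthogonal_independent) auto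
  then have finU: "finite ?U" by (rule independent_imp_finite)
  have disj: "B s \<inter> B t = {}" if "s \<in> ?S" "t \<in> ?S" "s \<noteq> t" for s t
    using orth[OF that] B(3) by (metis disjoint_iff orthogonal_self)
  have ne: "B s \<noteq> {}" if "s \<in> ?S" for s
    using B(5)[of s] that by (auto simp: sing_value_set_def)
  \<comment> \<open>Distinct singular values have disjoint nonempty bases inside the finite set
    \<open>?U\<close>, so there are only finitely many of them.\<close>
  have "inj_on B ?S" using disj ne unfolding inj_on_def by blast
  moreover have "finite (B ` ?S)" using finU by (rule finite_UnionD)
  ultimately show fin: "finite ?S" using finite_imageD by blast
  define W where "W = {y. \<forall>w\<in>?U. orthogonal w y}"
  have "subspace W" unfolding W_def
    by (auto simp: subspace_def orthogonal_def inner_right_distrib)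
  moreover have "(transpose A ** A) *v y \<in> W" if "y \<in> W" for y
  proof -
    have "w \<bullet> ((transpose A ** A) *v y) = 0" if w: "s \<in> ?S" "w \<in> B s" for s w
    proof -
      have "w \<bullet> ((transpose A ** A) *v y) = y \<bullet> ((transpose A ** A) *v w)"
        by (simp add: inner_gram inner_commute)
      moreover have "(transpose A ** A) *v w = s\<^sup>2 *\<^sub>R w"
        using B(1)[of s] w by (auto simp: gram_eigenspace_def)
      moreover have "w \<bullet> y = 0" using \<open>y \<in> W\<close> w by (auto simp: W_def orthogonal_def)
      ultimately show ?thesis by (simp add: inner_commute)
    qed
    then show ?thesis by (auto simp: W_def orthogonal_def)
  qed
  \<comment> \<open>An eigenvector in \<open>W\<close> would lie in the span of the basis of its own
    eigenspace and also be orthogonal to that basis.\<close>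
  moreover have False if v: "v \<in> W" "norm v = 1" "0 \<le> s" "v \<in> gram_eigenspace A (s\<^sup>2)" for v s
  proof -
    have "v \<noteq> 0" using v(2) by auto
    then have "s \<in> ?S" using v(3,4) unfolding sing_value_set_def by blast
    have "v \<in> span (B s)" using v B(5) by simp
    then have "orthogonal v v"
    proof (rule orthogonal_to_span)
      show "orthogonal v y" if "y \<in> B s" for y
        using v(1) \<open>s \<in> ?S\<close> that unfolding W_def orthogonal_commute[of v] by blast
    qed
    then show False using v(2) by (simp add: orthogonal_self)
  qed
  ultimately have W0: "W = {0}"
    by (rule_tac ccontr) (rule gram_eigenvector_minimal[of W A], assumption+)
  have "dim ?U = CARD('n)"
  proof (rule ccontr)
    assume "dim ?U \<noteq> CARD('n)"
    then have "dim ?U < DIM(real^'n)"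
      using dim_subset_UNIV[of ?U] by simp
    then obtain x where "x \<noteq> 0" "\<And>y. y \<in> span ?U \<Longrightarrow> orthogonal x y"
      using orthogonal_to_subspace_exists by blast
    then have "x \<in> W" by (auto simp: W_def orthogonal_commute intro: span_base)
    then show False using W0 \<open>x \<noteq> 0\<close> by blast
  qed
  then have "CARD('n) = card ?U" using ind by (simp add: dim_eq_card_independent)
  also have "\<dots> = (\<Sum>s\<in>?S. card (B s))"
  proof (rule card_UN_disjoint[OF fin])
    show "\<forall>s\<in>?S. finite (B s)" using finU by (meson UN_upper finite_subset)
  qed (use disj in blast)
  finally show "(\<Sum>s\<in>?S. dim (gram_eigenspace A (s\<^sup>2))) = CARD('n)" by (simp add: B(4))
qed

text \<open>Counting multiplicities gives the list exactly \<open>CARD('n)\<close> entries, so the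
  1-based index \<open>CARD('n)\<close> is its last entry, which comes from the block of the minimum
  because the sorted list is reversed.\<close>

lemma smallest_sing_value_eq_Min:
  fixes A :: "real^'n^'m"
  shows "sing_value_set A \<noteq> {}" and "sing_value A (CARD('n)) = Min (sing_value_set A)"
proof -
  let ?S = "sing_value_set A" and ?d = "\<lambda>s. dim (gram_eigenspace A (s\<^sup>2))"
  note fin = sum_dim_gram_eigenspace(1)[of A] and sum = sum_dim_gram_eigenspace(2)[of A]
  show ne: "?S \<noteq> {}" using sum by (metis card_eq_0_iff finite sum.empty UNIV_not_empty)
  define m where "m = Min ?S"
  have "m \<in> ?S" using ne fin by (simp add: m_def)
  have sv: "sing_values A =
      concat (map (\<lambda>s. replicate (?d s) s) (rev (sorted_list_of_set ?S)))"
    by (simp add: sing_values_def sing_value_set_def)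
  have "length (sing_values A) = sum_list (map ?d (sorted_list_of_set ?S))"
    by (simp add: sv length_concat rev_map[symmetric] comp_def sum_list_rev)
  then have len: "length (sing_values A) = CARD('n)"
    using sum fin by (simp add: sum_list_distinct_conv_sum_set)
  \<comment> \<open>The block of \<open>m\<close> is nonempty; otherwise the last entry would come
    from an earlier block.\<close>
  have pos: "?d m > 0"
    using \<open>m \<in> ?S\<close> subspace_0[OF subspace_gram_eigenspace[of A "m\<^sup>2"]]
    by (fastforce simp: sing_value_set_def dim_eq_0)
  have "sorted_list_of_set ?S = m # sorted_list_of_set (?S - {m})"
    unfolding m_def by (rule sorted_list_of_set_nonempty[OF fin ne])
  then have "last (sing_values A) = m" "sing_values A \<noteq> []"
    using pos by (simp_all add: sv last_append del: dim_eq_0)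
  then show "sing_value A (CARD('n)) = Min ?S"
    using len by (simp add: last_conv_nth sing_value_def m_def)
qed

text \<open>The interface to the list definition: everything later uses singular values only through
  these three facts.\<close>

lemma smallest_sing_value:
  fixes A :: "real^'n^'m"
  shows smallest_sing_value_nonneg: "0 \<le> sing_value A (CARD('n))"
    and smallest_sing_value_le: "sing_value A (CARD('n)) * norm w \<le> norm (A *v w)"
    and smallest_sing_value_attained: "\<exists>v. v \<noteq> 0 \<and> v \<in> gram_eigenspace A ((sing_value A (CARD('n)))\<^sup>2)"
proof -
  let ?S = "sing_value_set A" and ?m = "sing_value A (CARD('n))"
  have m: "?m = Min ?S" and fin: "finite ?S" and ne: "?S \<noteq> {}"
    using smallest_sing_value_eq_Min[of A] sum_dim_gram_eigenspace[of A] by auto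
  have mem: "?m \<in> ?S" unfolding m using ne fin by (rule Min_in[rotated])
  then show "0 \<le> ?m" by (simp add: sing_value_set_def)
  show "\<exists>v. v \<noteq> 0 \<and> v \<in> gram_eigenspace A (?m\<^sup>2)"
    using mem subspace_0[OF subspace_gram_eigenspace[of A "?m\<^sup>2"]] by (auto simp: sing_value_set_def)
  have nontriv: "(UNIV :: (real^'n) set) \<noteq> {0}"
    by (metis UNIV_I axis_eq_0_iff singletonD zero_neq_one)
  obtain v s where v: "v \<in> UNIV" "norm v = 1" "0 \<le> s" "v \<in> gram_eigenspace A (s\<^sup>2)"
    and le: "\<And>w. w \<in> UNIV \<Longrightarrow> s * norm w \<le> norm (A *v w)"
    by (rule gram_eigenvector_minimal[OF subspace_UNIV nontriv UNIV_I, where A = A], rule that)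
  have "v \<noteq> 0" using v(2) by auto
  then have "s \<in> ?S" using v(3,4) unfolding sing_value_set_def by blast
  then have "?m \<le> s" using m fin by simp
  then have "?m * norm w \<le> s * norm w" by (rule mult_right_mono) simp
  then show "?m * norm w \<le> norm (A *v w)" using le[OF UNIV_I, of w] by linarith
qed

text \<open>As a simp rule this would turn products with a transpose into \<open>v*\<close>, away
  from the form of \<open>inner_matrix_transpose\<close>.\<close>

declare transpose_matrix_vector [simp del]

section \<open>The augmented matrix\<close>

lemma sum_UNIV_option:
  fixes f :: "'a::finite option \<Rightarrow> 'b::comm_monoid_add"
  shows "(\<Sum>j\<in>UNIV. f j) = f None + (\<Sum>k\<in>UNIV. f (Some k))"
  unfolding UNIV_option_conv by (subst sum.insert) (auto simp: sum.reindex)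

definition extend :: "real^'n \<Rightarrow> real \<Rightarrow> real^('n option)" where
  "extend y t = (\<chi> j. case j of Some k \<Rightarrow> y $ k | None \<Rightarrow> t)"

lemma extend_cases: obtains y t where "z = extend y t"
proof
  show "z = extend (\<chi> k. z $ Some k) (z $ None)"
    by (simp add: extend_def vec_eq_iff split: option.split)
qed

lemma extend_eq_iff [simp]: "extend y t = extend y' t' \<longleftrightarrow> y = y' \<and> t = t'"
  by (auto simp: extend_def vec_eq_iff split_option_all)

lemma extend_0 [simp]: "extend 0 0 = 0"
  by (simp add: extend_def vec_eq_iff split: option.split)

lemma scaleR_extend: "c *\<^sub>R extend y t = extend (c *\<^sub>R y) (c * t)"
  by (simp add: extend_def vec_eq_iff split: option.split)

lemma inner_extend: "extend y t \<bullet> extend y' t' = y \<bullet> y' + t * t'"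
  by (simp add: extend_def inner_vec_def sum_UNIV_option)

lemma augment_mult: "augment A b *v extend y t = A *v y + t *\<^sub>R b"
  by (simp add: augment_def extend_def matrix_vector_mult_def vec_eq_iff sum_UNIV_option)

lemma transpose_augment_mult:
  "transpose (augment A b) *v u = extend (transpose A *v u) (b \<bullet> u)"
  by (simp add: augment_def extend_def matrix_vector_mult_def vec_eq_iff transpose_def
      inner_vec_def split: option.split)

lemma augment_gram_mult:
  "(transpose (augment A b) ** augment A b) *v extend y t =
    extend (transpose A *v (A *v y + t *\<^sub>R b)) (b \<bullet> (A *v y + t *\<^sub>R b))"
  by (simp add: augment_mult transpose_augment_mult flip: matrix_vector_mul_assoc)

lemma norm_augment: "(norm (augment A b))\<^sup>2 = (norm A)\<^sup>2 + (norm b)\<^sup>2"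
  unfolding power2_norm_eq_inner
  by (simp add: augment_def inner_vec_def sum_UNIV_option sum.distrib)

section \<open>The Frobenius norm and rank-one matrices\<close>

text \<open>Cauchy-Schwarz in each row: the Frobenius norm dominates the spectral norm.\<close>

lemma norm_matrix_vector_le_Frobenius:
  fixes A :: "real^'n^'m"
  shows "norm (A *v y) \<le> norm A * norm y"
proof -
  have "norm (A *v y) \<le> L2_set (\<lambda>i. norm (A $ i) * norm y) UNIV"
    unfolding norm_vec_def[of "A *v y"]
    by (intro L2_set_mono) (auto simp: matrix_vector_mul_component Cauchy_Schwarz_ineq2)
  also have "\<dots> = norm A * norm y"
    by (simp add: norm_vec_def[of A] L2_set_left_distrib)
  finally show ?thesis .
qed

text \<open>The rank-one matrix u w^T. It serves both as the optimal correction of \<open>A\<close>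
  and as the matrix part of the adjoint of the derivative.\<close>

definition outer :: "real^'m \<Rightarrow> real^'n \<Rightarrow> real^'n^'m" where
  "outer u w = (\<chi> i j. u $ i * w $ j)"

lemma outer_mult: "outer u w *v y = (w \<bullet> y) *\<^sub>R u"
  by (simp add: outer_def vec_eq_iff matrix_vector_mult_def inner_vec_def sum_distrib_left
      sum_distrib_right mult_ac)

lemma inner_outer: "E \<bullet> outer u w = u \<bullet> (E *v w)"
  by (simp add: outer_def inner_vec_def matrix_vector_mult_def sum_distrib_left mult_ac)

lemma norm_outer: "norm (outer u w) = norm u * norm w"
proof -
  have "(norm (outer u w))\<^sup>2 = (norm u * norm w)\<^sup>2"
    unfolding power_mult_distrib power2_norm_eq_inner
    by (simp add: inner_outer outer_mult)
  then show ?thesis by (simp add: power2_eq_iff_nonneg)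
qed

section \<open>Characterisation of the total least squares solution\<close>

abbreviation (input) tls_sv :: "real^'n^'m \<Rightarrow> real^'m \<Rightarrow> real" where
  "tls_sv A b \<equiv> sing_value (augment A b) (CARD('n) + 1)"

abbreviation (input) min_sv :: "real^'n^'m \<Rightarrow> real" where
  "min_sv A \<equiv> sing_value A (CARD('n))"

lemma CARD_option: "CARD('n::finite option) = CARD('n) + 1"
  by simp

text \<open>The columns of \<open>augment A b\<close> are indexed by \<open>'n option\<close>, so
  its smallest singular value has index \<open>CARD('n) + 1\<close>. The three facts are, in order,
  nonnegativity, the lower bound and attainment.\<close>

lemmas tls_sv = smallest_sing_value[of "augment A b" for A b, unfolded CARD_option]

text \<open>The two blocks of the eigenvector equation for \<open>extend x (-1)\<close> and the Gram
  matrix of \<open>augment A b\<close>.\<close>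

definition tls_eqs :: "real^'n^'m \<Rightarrow> real^'m \<Rightarrow> real^'n \<Rightarrow> bool" where
  "tls_eqs A b x \<longleftrightarrow> transpose A *v (A *v x - b) = (tls_sv A b)\<^sup>2 *\<^sub>R x \<and>
     b \<bullet> (A *v x - b) = - (tls_sv A b)\<^sup>2"

text \<open>The last component of the singular vector cannot vanish: otherwise its remaining part
  would be an eigenvector of the Gram matrix of \<open>A\<close> with too small an eigenvalue.\<close>

lemma tls_eqs_exists:
  fixes A :: "real^'n^'m"
  assumes "tls_sv A b < min_sv A"
  obtains x where "tls_eqs A b x"
proof -
  obtain y t where ne: "extend y t \<noteq> 0"
    and eig: "extend y t \<in> gram_eigenspace (augment A b) ((tls_sv A b)\<^sup>2)"
    using tls_sv(3)[of A b] by (metis extend_cases)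
  let ?l = "(tls_sv A b)\<^sup>2"
  have e1: "transpose A *v (A *v y + t *\<^sub>R b) = ?l *\<^sub>R y"
    and e2: "b \<bullet> (A *v y + t *\<^sub>R b) = ?l * t"
    using eig by (simp_all add: gram_eigenspace_def augment_gram_mult scaleR_extend)
  have "t \<noteq> 0"
  proof
    assume "t = 0"
    then have "y \<noteq> 0" using ne by auto
    have "y \<in> gram_eigenspace A ?l"
      using e1 \<open>t = 0\<close> by (simp add: gram_eigenspace_def flip: matrix_vector_mul_assoc)
    then have "(norm (A *v y))\<^sup>2 = (tls_sv A b * norm y)\<^sup>2"
      by (simp add: gram_eigenspace_norm power_mult_distrib)
    then have "norm (A *v y) = tls_sv A b * norm y"
      using tls_sv(1)[of A b] by (simp add: power2_eq_iff_nonneg)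
    also have "\<dots> < min_sv A * norm y" using assms \<open>y \<noteq> 0\<close> by simp
    finally show False using smallest_sing_value_le[of A y] by linarith
  qed
  \<comment> \<open>Scaling by \<open>- 1 / t\<close> turns the last component of the singular
    vector into -1.\<close>
  let ?x = "(- 1 / t) *\<^sub>R y"
  have r: "A *v ?x - b = (- 1 / t) *\<^sub>R (A *v y + t *\<^sub>R b)"
    using \<open>t \<noteq> 0\<close> unfolding matrix_vector_mult_scaleR by (simp add: scaleR_right_distrib)
  have "tls_eqs A b ?x"
    unfolding tls_eqs_def r using e1 e2 \<open>t \<noteq> 0\<close>
    by (simp only: matrix_vector_mult_scaleR inner_scaleR_right) simp
  then show thesis by (rule that)
qed

text \<open>The quotient of \<open>|A x - b|^2\<close> by \<open>1 + |x|^2\<close> is the Rayleigh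
  quotient of \<open>extend x (-1)\<close>, which equals the eigenvalue.\<close>

lemma tls_eqs_residual:
  assumes "tls_eqs A b x"
  shows "(norm (A *v x - b))\<^sup>2 = (tls_sv A b)\<^sup>2 * (1 + (norm x)\<^sup>2)"
proof -
  have "(A *v x - b) \<bullet> (A *v x - b) = x \<bullet> (transpose A *v (A *v x - b)) - b \<bullet> (A *v x - b)"
    by (metis inner_diff_left inner_matrix_transpose)
  then show ?thesis
    using assms by (simp add: tls_eqs_def power2_norm_eq_inner algebra_simps)
qed

text \<open>Expanding around \<open>x0\<close>, the cross terms cancel by the eigenvector equations.
  What remains bounds \<open>|A w|\<close> by \<open>tls_sv A b * |w|\<close> for
  \<open>w = x - x0\<close>, which the gap allows only for \<open>w = 0\<close>.\<close>

lemma tls_eqs_unique: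
  fixes A :: "real^'n^'m"
  assumes gap: "tls_sv A b < min_sv A" and x0: "tls_eqs A b x0"
    and le: "(norm (A *v x - b))\<^sup>2 \<le> (tls_sv A b)\<^sup>2 * (1 + (norm x)\<^sup>2)"
  shows "x = x0"
proof -
  define w where "w = x - x0"
  let ?l = "(tls_sv A b)\<^sup>2"
  have x: "x = x0 + w" by (simp add: w_def)
  have r: "A *v x - b = (A *v x0 - b) + A *v w"
    by (simp add: x matrix_vector_right_distrib)
  have "(A *v w) \<bullet> (A *v x0 - b) = ?l * (w \<bullet> x0)"
    using x0 by (simp add: inner_matrix_transpose tls_eqs_def)
  then have "(norm (A *v x - b))\<^sup>2 =
      (norm (A *v x0 - b))\<^sup>2 + 2 * ?l * (w \<bullet> x0) + (norm (A *v w))\<^sup>2"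
    unfolding r power2_norm_eq_inner by (simp add: inner_add inner_commute)
  moreover have "(norm x)\<^sup>2 = (norm x0)\<^sup>2 + 2 * (w \<bullet> x0) + (norm w)\<^sup>2"
    unfolding x power2_norm_eq_inner by (simp add: inner_add inner_commute)
  ultimately have "(norm (A *v w))\<^sup>2 \<le> ?l * (norm w)\<^sup>2"
    using le tls_eqs_residual[OF x0] by (simp add: algebra_simps)
  then have "norm (A *v w) \<le> tls_sv A b * norm w"
    using tls_sv(1)[of A b] by (simp add: power_mult_distrib[symmetric] power2_le_iff_abs_le)
  then have "min_sv A * norm w \<le> tls_sv A b * norm w"
    using smallest_sing_value_le[of A w] by linarith
  then have "w = 0" using gap by (simp add: mult_le_cancel_right)
  then show ?thesis by (simp add: x)
qed

text \<open>An explicit feasible correction of norm \<open>tls_sv A b\<close> bounds the norm of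
  every minimiser. This bounds the residual of \<open>x\<close> as \<open>tls_eqs_unique\<close>
  requires.\<close>

lemma tls_solution_eqs:
  fixes A :: "real^'n^'m"
  assumes gap: "tls_sv A b < min_sv A" and sol: "tls_solution A b x"
  shows "tls_eqs A b x"
proof -
  obtain x0 where x0: "tls_eqs A b x0" using tls_eqs_exists[OF gap] .
  let ?s = "tls_sv A b"
  let ?r = "A *v x0 - b"
  define q where "q = 1 + (norm x0)\<^sup>2"
  have q: "q > 0" by (simp add: q_def add_pos_nonneg)
  \<comment> \<open>With v the unit vector along \<open>(x0, -1)\<close>, the matrix
    \<open>[E0, -r0]\<close> is \<open>-[A b] v v^T\<close>: adding it to \<open>[A b]\<close>
    annihilates the smallest right singular vector.\<close>
  define E0 where "E0 = outer ((- 1 / q) *\<^sub>R ?r) x0"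
  define r0 where "r0 = (- 1 / q) *\<^sub>R ?r"
  have "b - r0 = (A + E0) *v x0"
  proof -
    have "(A + E0) *v x0 + r0 = A *v x0 - ((norm x0)\<^sup>2 / q + 1 / q) *\<^sub>R ?r"
      unfolding E0_def r0_def matrix_vector_mult_add_rdistrib outer_mult
      by (simp add: power2_norm_eq_inner scaleR_left_distrib)
    also have "(norm x0)\<^sup>2 / q + 1 / q = 1" using q by (simp add: q_def field_simps)
    finally show ?thesis by (simp add: algebra_simps)
  qed
  then have "tls_feasible A b E0 r0" by (auto simp: tls_feasible_def)
  moreover have "norm (augment E0 r0) = ?s"
  proof -
    have "norm r0 = norm ?r / q" using q by (simp only: r0_def norm_scaleR) simp
    then have "(norm (augment E0 r0))\<^sup>2 = (norm ?r / q)\<^sup>2 * (norm x0)\<^sup>2 + (norm ?r / q)\<^sup>2"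
      by (simp only: norm_augment E0_def norm_outer power_mult_distrib flip: r0_def)
    also have "\<dots> = (norm ?r)\<^sup>2 / q\<^sup>2 * q"
      by (simp add: q_def algebra_simps power_divide add_divide_distrib)
    also have "\<dots> = ?s\<^sup>2"
      using q tls_eqs_residual[OF x0, folded q_def] by (simp add: power2_eq_square[of q])
    finally show ?thesis using tls_sv(1)[of A b] by (simp add: power2_eq_iff_nonneg)
  qed
  moreover obtain E r where Er: "tls_minimizer A b E r" "(A + E) *v x = b - r"
    using sol by (auto simp: tls_solution_def)
  ultimately have small: "norm (augment E r) \<le> ?s" unfolding tls_minimizer_def by metis
  \<comment> \<open>The last component is +1 here because feasibility subtracts \<open>r\<close>
    from \<open>b\<close>, so the residual is \<open>-(E x + r)\<close>.\<close>
  have "A *v x - b = - (augment E r *v extend x 1)"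
    using Er(2) by (simp add: augment_mult matrix_vector_mult_add_rdistrib algebra_simps)
  then have "norm (A *v x - b) \<le> norm (augment E r) * norm (extend x 1)"
    by (simp add: norm_matrix_vector_le_Frobenius)
  also have "\<dots> \<le> ?s * norm (extend x 1)" using small by (intro mult_right_mono) auto
  finally have "(norm (A *v x - b))\<^sup>2 \<le> (?s * norm (extend x 1))\<^sup>2"
    by (intro power_mono) auto
  also have "\<dots> = ?s\<^sup>2 * (1 + (norm x)\<^sup>2)"
    by (simp add: power_mult_distrib power2_norm_eq_inner inner_extend)
  finally have "x = x0" by (rule tls_eqs_unique[OF gap x0])
  then show ?thesis using x0 by simp
qed

section \<open>The shifted Gram matrix and the closed form of the solution\<close>

definition tls_gram :: "real^'n^'m \<Rightarrow> real^'m \<Rightarrow> real^'n^'n" where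
  "tls_gram A b = transpose A ** A - (tls_sv A b)\<^sup>2 *\<^sub>R mat 1"

lemma tls_gram_mult: "tls_gram A b *v w = transpose A *v (A *v w) - (tls_sv A b)\<^sup>2 *\<^sub>R w"
  by (simp add: tls_gram_def matrix_vector_mult_diff_rdistrib scaleR_matrix_vector_assoc[symmetric]
      flip: matrix_vector_mul_assoc)

lemma inner_tls_gram:
  "v \<bullet> (tls_gram A b *v w) = (A *v v) \<bullet> (A *v w) - (tls_sv A b)\<^sup>2 * (v \<bullet> w)"
  by (simp add: tls_gram_mult inner_diff_right flip: inner_matrix_transpose)

lemma inner_tls_gram_self:
  "w \<bullet> (tls_gram A b *v w) = (norm (A *v w))\<^sup>2 - (tls_sv A b)\<^sup>2 * (norm w)\<^sup>2"
  by (simp add: inner_tls_gram power2_norm_eq_inner)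

lemma inner_tls_gram_commute: "(tls_gram A b *v v) \<bullet> w = v \<bullet> (tls_gram A b *v w)"
  by (metis inner_commute inner_tls_gram)

text \<open>Pair with \<open>w\<close> and use Cauchy-Schwarz. Under the gap condition the factor is
  positive, which gives injectivity and a bound for the inverse.\<close>

lemma norm_tls_gram_ge:
  fixes A :: "real^'n^'m"
  shows "((min_sv A)\<^sup>2 - (tls_sv A b)\<^sup>2) * norm w \<le> norm (tls_gram A b *v w)"
proof (cases "w = 0")
  case False
  have "(min_sv A * norm w)\<^sup>2 \<le> (norm (A *v w))\<^sup>2"
    using smallest_sing_value_nonneg[of A] smallest_sing_value_le[of A w]
    by (intro power_mono) auto
  then have "((min_sv A)\<^sup>2 - (tls_sv A b)\<^sup>2) * (norm w)\<^sup>2 \<le> w \<bullet> (tls_gram A b *v w)"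
    by (simp add: inner_tls_gram_self power_mult_distrib algebra_simps)
  also have "\<dots> \<le> norm w * norm (tls_gram A b *v w)" by (rule norm_cauchy_schwarz)
  finally show ?thesis using False by (simp add: power2_eq_square)
qed simp

text \<open>\<open>matrix_inv\<close> is defined by choice; an injective square matrix is
  invertible, so the chosen matrix is a two-sided inverse.\<close>

lemma matrix_inv_cancel:
  fixes M :: "real^'n^'n"
  assumes "inj ((*v) M)"
  shows "matrix_inv M *v (M *v w) = w" and "M *v (matrix_inv M *v w) = w"
proof -
  have "invertible M"
    using assms matrix_left_invertible_injective[of M] invertible_left_inverse[of M] by blast
  then have "M ** matrix_inv M = mat 1 \<and> matrix_inv M ** M = mat 1"
    unfolding invertible_def matrix_inv_def by (rule someI_ex)
  then show "matrix_inv M *v (M *v w) = w" and "M *v (matrix_inv M *v w) = w"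
    by (simp_all add: matrix_vector_mul_assoc)
qed

lemma inj_tls_gram:
  fixes A :: "real^'n^'m"
  assumes "tls_sv A b < min_sv A"
  shows "inj ((*v) (tls_gram A b))"
proof (rule injI)
  fix v w assume "tls_gram A b *v v = tls_gram A b *v w"
  then have "tls_gram A b *v (v - w) = 0" by (simp add: matrix_vector_mult_diff_distrib)
  then have "((min_sv A)\<^sup>2 - (tls_sv A b)\<^sup>2) * norm (v - w) \<le> 0"
    using norm_tls_gram_ge[of A b "v - w"] by simp
  moreover have "(tls_sv A b)\<^sup>2 < (min_sv A)\<^sup>2"
    using assms tls_sv(1)[of A b] by (simp add: power_strict_mono)
  ultimately show "v = w" by (simp add: mult_le_0_iff)
qed

text \<open>The first eigenvector equation rearranges to \<open>M x = A^T b\<close> with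
  \<open>M = tls_gram A b\<close>, which the closed formula solves.\<close>

lemma tls_map_eqs:
  fixes p :: "real^(('n::finite \<times> 'm::finite) + 'm)"
  assumes gap: "tls_sv (data_matrix p) (data_rhs p) < min_sv (data_matrix p)"
    and eqs: "tls_eqs (data_matrix p) (data_rhs p) x"
  shows "tls_map p = x"
proof -
  have "tls_gram (data_matrix p) (data_rhs p) *v x = transpose (data_matrix p) *v data_rhs p"
    using eqs by (simp add: tls_eqs_def tls_gram_mult matrix_vector_mult_diff_distrib algebra_simps)
  then show ?thesis
    using matrix_inv_cancel(1)[OF inj_tls_gram[OF gap], of x]
    by (simp add: tls_map_def tls_gram_def)
qed

section \<open>Differentiability of the solution map\<close>

text \<open>A product rule in which the second factor need only be continuous, since the first one
  vanishes at \<open>p\<close>. It allows products with \<open>tls_map\<close> to be differentiated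
  when only continuity of \<open>tls_map\<close> is known.\<close>

lemma (in bounded_bilinear) has_derivative_vanishing:
  fixes f :: "'d::real_normed_vector \<Rightarrow> 'a"
  assumes f: "(f has_derivative f') (at p)" and f0: "f p = 0" and g: "isCont g p"
  shows "((\<lambda>x. prod (f x) (g x)) has_derivative (\<lambda>h. prod (f' h) (g p))) (at p)"
proof -
  interpret f': bounded_linear f' using f by (rule has_derivative_bounded_linear)
  obtain K where K: "K > 0" "\<And>a b. norm (prod a b) \<le> norm a * norm b * K"
    using pos_bounded by blast
  obtain L where L: "\<And>h. norm (f' h) \<le> norm h * L"
    using f'.bounded by blast
  let ?e = "\<lambda>h. norm (f (p + h) - f' h) / norm h"
  let ?q = "\<lambda>h. norm (prod (f (p + h)) (g (p + h)) - prod (f p) (g p) - prod (f' h) (g p)) / norm h"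
  have e: "?e \<midarrow>0\<rightarrow> 0" using f f0 by (simp add: has_derivative_at)
  have gl: "(\<lambda>h. g (p + h)) \<midarrow>0\<rightarrow> g p"
    using g by (simp add: isCont_def LIM_offset_zero_iff)
  have "(\<lambda>h. ?e h * norm (g (p + h)) * K + L * norm (g (p + h) - g p) * K) \<midarrow>0\<rightarrow> 0"
  proof -
    have "(\<lambda>h. ?e h * norm (g (p + h)) * K + L * norm (g (p + h) - g p) * K) \<midarrow>0\<rightarrow>
        0 * norm (g p) * K + L * norm (g p - g p) * K"
      by (intro tendsto_intros e gl)
    then show ?thesis by simp
  qed
  then have "?q \<midarrow>0\<rightarrow> 0"
  proof (rule Lim_null_comparison[rotated], intro always_eventually allI)
    fix h
    show "norm (?q h) \<le> ?e h * norm (g (p + h)) * K + L * norm (g (p + h) - g p) * K"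
    proof (cases "h = 0")
      case True
      then show ?thesis using K(1) by (simp add: f0 zero_left f'.zero)
    next
      case False
      have "prod (f (p + h)) (g (p + h)) - prod (f p) (g p) - prod (f' h) (g p) =
          prod (f (p + h) - f' h) (g (p + h)) + prod (f' h) (g (p + h) - g p)"
        by (simp add: f0 zero_left diff_left diff_right)
      then have "norm (prod (f (p + h)) (g (p + h)) - prod (f p) (g p) - prod (f' h) (g p)) \<le>
          norm (prod (f (p + h) - f' h) (g (p + h))) + norm (prod (f' h) (g (p + h) - g p))"
        by (simp add: norm_triangle_ineq)
      also have "\<dots> \<le> norm (f (p + h) - f' h) * norm (g (p + h)) * K +
          (norm h * L) * norm (g (p + h) - g p) * K"
        using K(1) L by (intro add_mono order_trans[OF K(2)] mult_right_mono) auto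
      finally show ?thesis using False by (simp add: field_simps)
    qed
  qed
  moreover have "bounded_linear (\<lambda>h. prod (f' h) (g p))"
    by (rule bounded_linear_compose[OF bounded_linear_left f'.bounded_linear_axioms])
  ultimately show ?thesis by (simp add: has_derivative_at)
qed

text \<open>A Weyl-type bound: apply \<open>X\<close> to a vector at which \<open>Y\<close> attains
  its smallest singular value, then exchange the roles.\<close>

lemma smallest_sing_value_diff_le:
  fixes X Y :: "real^'n^'m"
  shows "\<bar>min_sv X - min_sv Y\<bar> \<le> norm (X - Y)"
proof -
  have *: "min_sv X - min_sv Y \<le> norm (X - Y)" for X Y :: "real^'n^'m"
  proof -
    obtain v where v: "v \<noteq> 0" "v \<in> gram_eigenspace Y ((min_sv Y)\<^sup>2)"
      using smallest_sing_value_attained[of Y] by blast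
    have "(norm (Y *v v))\<^sup>2 = (min_sv Y * norm v)\<^sup>2"
      using gram_eigenspace_norm[OF v(2)] by (simp add: power_mult_distrib)
    then have Yv: "norm (Y *v v) = min_sv Y * norm v"
      using smallest_sing_value_nonneg[of Y] by (simp add: power2_eq_iff_nonneg)
    have "min_sv X * norm v \<le> norm (X *v v)" by (rule smallest_sing_value_le)
    also have "X *v v = Y *v v + (X - Y) *v v"
      by (simp add: matrix_vector_mult_diff_rdistrib)
    also have "norm \<dots> \<le> min_sv Y * norm v + norm (X - Y) * norm v"
      using norm_matrix_vector_le_Frobenius[of "X - Y" v] by (intro norm_triangle_le) (simp add: Yv)
    finally have "(min_sv X - min_sv Y) * norm v \<le> norm (X - Y) * norm v"
      by (simp add: algebra_simps)
    then show ?thesis using v(1) by simp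
  qed
  show ?thesis using *[of X Y] *[of Y X] by (simp add: abs_le_iff norm_minus_commute)
qed

lemma isCont_min_sv: "isCont (min_sv :: real^'n^'m \<Rightarrow> real) X"
proof -
  have "(\<lambda>Y. norm (Y - X)) \<midarrow>X\<rightarrow> 0"
    by (intro tendsto_norm_zero LIM_zero tendsto_ident_at)
  then have "(\<lambda>Y. min_sv Y - min_sv X) \<midarrow>X\<rightarrow> 0"
    using smallest_sing_value_diff_le
    by (intro Lim_null_comparison[where f = "\<lambda>Y. min_sv Y - min_sv X" and g = "\<lambda>Y. norm (Y - X)"])
      (auto intro!: always_eventually)
  then show ?thesis by (simp add: isCont_def LIM_zero_iff)
qed

lemma bounded_linear_data_matrix: "bounded_linear data_matrix"
  unfolding linear_conv_bounded_linear[symmetric]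
  by (rule linearI) (simp_all add: data_matrix_def vec_eq_iff)

lemma bounded_linear_data_rhs: "bounded_linear data_rhs"
  unfolding linear_conv_bounded_linear[symmetric]
  by (rule linearI) (simp_all add: data_rhs_def vec_eq_iff)

lemma bounded_linear_data_augment: "bounded_linear (\<lambda>p. augment (data_matrix p) (data_rhs p))"
  unfolding linear_conv_bounded_linear[symmetric]
  by (rule linearI) (simp_all add: data_matrix_def data_rhs_def augment_def vec_eq_iff split: option.split)

lemma bounded_bilinear_matrix_vector_mult: "bounded_bilinear ((*v) :: real^'n^'m \<Rightarrow> _)"
  unfolding bilinear_conv_bounded_bilinear[symmetric] bilinear_def
  by (auto intro!: linearI simp: matrix_vector_right_distrib matrix_vector_mult_add_rdistrib
      matrix_vector_mult_scaleR scaleR_matrix_vector_assoc)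

lemma bounded_linear_transpose: "bounded_linear (transpose :: real^'n^'m \<Rightarrow> _)"
  unfolding linear_conv_bounded_linear[symmetric]
  by (rule linearI) (simp_all add: transpose_def vec_eq_iff)

lemmas isCont_mult_vec = bounded_bilinear.isCont[OF bounded_bilinear_matrix_vector_mult]
lemmas isCont_transpose = bounded_linear.isCont[OF bounded_linear_transpose]
lemmas isCont_data = bounded_linear.isCont[OF bounded_linear_data_matrix]
  bounded_linear.isCont[OF bounded_linear_data_rhs]

lemma isCont_tls_sv:
  fixes p :: "real^(('n::finite \<times> 'm::finite) + 'm)"
  shows "isCont (\<lambda>p. tls_sv (data_matrix p) (data_rhs p)) p"
proof -
  have "isCont (\<lambda>p. augment (data_matrix p) (data_rhs p)) p"
    by (rule bounded_linear.isCont[OF bounded_linear_data_augment]) simp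
  then have "isCont (\<lambda>p. min_sv (augment (data_matrix p) (data_rhs p))) p"
    by (rule isCont_o2) (rule isCont_min_sv)
  then show ?thesis by simp
qed

lemma isCont_tendsto_nhds: "isCont f p \<Longrightarrow> (f \<longlongrightarrow> f p) (nhds p)"
  unfolding isCont_def by (rule tendsto_at_iff_tendsto_nhds[THEN iffD1])

section \<open>The candidate derivative and exact increments\<close>

text \<open>The quotient \<open>2 * (r \<bullet> u) / (1 + |x|^2)\<close> is the derivative of the
  squared singular value. Where \<open>tls_eqs\<close> holds and r is nonzero, the terms in
  \<open>x\<close> and \<open>u\<close> combine to \<open>-A^T H u\<close> for the reflection H
  along r, as \<open>A^T r = l x\<close> and \<open>|r|^2 = l (1 + |x|^2)\<close> with
  \<open>l = (tls_sv A b)^2\<close>.\<close>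

definition tls_deriv ::
  "real^'n^'m \<Rightarrow> real^'m \<Rightarrow> real^'n \<Rightarrow> real^(('n \<times> 'm) + 'm) \<Rightarrow> real^'n" where
  "tls_deriv A b x h =
     (let r = A *v x - b; u = data_matrix h *v x - data_rhs h
      in matrix_inv (tls_gram A b) *v
          ((2 * (r \<bullet> u) / (1 + (norm x)\<^sup>2)) *\<^sub>R x - transpose (data_matrix h) *v r - transpose A *v u))"

context
  fixes A :: "real^'n^'m" and b :: "real^'m" and x :: "real^'n"
    and p0 :: "real^(('n \<times> 'm) + 'm)"
  assumes gap: "tls_sv A b < min_sv A" and eqs: "tls_eqs A b x"
    and p0: "p0 = stack_data A b"
begin

abbreviation "dA p \<equiv> data_matrix p - A"
abbreviation "db p \<equiv> data_rhs p - b"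
abbreviation "sv p \<equiv> tls_sv (data_matrix p) (data_rhs p)"
abbreviation "res p \<equiv> data_matrix p *v tls_map p - data_rhs p"

lemma at_p0: "data_matrix p0 = A" "data_rhs p0 = b" "tls_map p0 = x"
  using gap eqs by (auto simp: p0 intro!: tls_map_eqs)

text \<open>The gap is an open condition because both singular values are continuous. Hence the
  eigenvector equations hold on a whole neighbourhood.\<close>

lemma eventually_gap: "\<forall>\<^sub>F p in nhds p0. sv p < min_sv (data_matrix p)"
proof -
  have "isCont (\<lambda>p. min_sv (data_matrix p) - sv p) p0"
    by (intro isCont_diff isCont_tls_sv isCont_o2[OF _ isCont_min_sv] isCont_data) simp
  then have "((\<lambda>p. min_sv (data_matrix p) - sv p) \<longlongrightarrow> min_sv A - tls_sv A b) (nhds p0)"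
    by (drule_tac isCont_tendsto_nhds) (simp add: at_p0)
  then have "\<forall>\<^sub>F p in nhds p0. 0 < min_sv (data_matrix p) - sv p"
    using gap by (intro order_tendstoD(1)) auto
  then show ?thesis by (rule eventually_mono) simp
qed

lemma eventually_tls_eqs: "\<forall>\<^sub>F p in nhds p0. tls_eqs (data_matrix p) (data_rhs p) (tls_map p)"
  using eventually_gap
proof (rule eventually_mono)
  fix p assume g: "sv p < min_sv (data_matrix p)"
  obtain y where "tls_eqs (data_matrix p) (data_rhs p) y" using tls_eqs_exists[OF g] .
  then show "tls_eqs (data_matrix p) (data_rhs p) (tls_map p)" using tls_map_eqs[OF g] by simp
qed

text \<open>The old solution \<open>x\<close> violates the perturbed first equation by
  \<open>e p\<close>, and \<open>e p\<close> is the perturbed shifted Gram matrix applied to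
  \<open>x - tls_map p\<close>. So the error is at most \<open>|e p| / \<mu> p\<close>, with
  \<open>e p\<close> tending to 0 and \<open>\<mu> p\<close> to a positive limit.\<close>

lemma isCont_tls_map: "isCont tls_map p0"
proof -
  define e :: "real^(('n \<times> 'm) + 'm) \<Rightarrow> real^'n"
    where "e p =
      transpose (data_matrix p) *v (data_matrix p *v x - data_rhs p) - (sv p)\<^sup>2 *\<^sub>R x" for p
  define \<mu> :: "real^(('n \<times> 'm) + 'm) \<Rightarrow> real"
    where "\<mu> p = (min_sv (data_matrix p))\<^sup>2 - (sv p)\<^sup>2" for p
  have "isCont e p0" unfolding e_def
    by (intro isCont_diff isCont_mult_vec isCont_transpose isCont_data isCont_scaleR isCont_power
        isCont_tls_sv continuous_const) simp_all
  moreover have "e p0 = 0" using eqs by (simp add: e_def at_p0 tls_eqs_def)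
  moreover have "isCont \<mu> p0" unfolding \<mu>_def
    by (intro isCont_diff isCont_power isCont_tls_sv isCont_o2[OF _ isCont_min_sv] isCont_data) simp
  moreover have "\<mu> p0 > 0"
    using gap tls_sv(1)[of A b] by (simp add: \<mu>_def at_p0 power_strict_mono)
  ultimately have "((\<lambda>p. norm (e p) / \<mu> p) \<longlongrightarrow> norm (e p0) / \<mu> p0) (at p0)"
    unfolding isCont_def by (intro tendsto_intros) auto
  then have lim: "((\<lambda>p. norm (e p) / \<mu> p) \<longlongrightarrow> 0) (at p0)" by (simp add: \<open>e p0 = 0\<close>)
  have "\<forall>\<^sub>F p in at p0. sv p < min_sv (data_matrix p) \<and>
      tls_eqs (data_matrix p) (data_rhs p) (tls_map p)"
    using eventually_conj[OF eventually_gap eventually_tls_eqs] unfolding eventually_nhds_conv_at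
    by (rule conjunct1)
  then have "\<forall>\<^sub>F p in at p0. norm (tls_map p - x) \<le> norm (e p) / \<mu> p"
  proof (rule eventually_mono)
    fix p :: "real^(('n \<times> 'm) + 'm)"
    assume *: "sv p < min_sv (data_matrix p) \<and> tls_eqs (data_matrix p) (data_rhs p) (tls_map p)"
    have "tls_gram (data_matrix p) (data_rhs p) *v (x - tls_map p) = e p"
      using * by (simp add: e_def tls_eqs_def tls_gram_mult matrix_vector_mult_diff_distrib
          scaleR_right_diff_distrib diff_eq_eq eq_diff_eq)
    then have "\<mu> p * norm (tls_map p - x) \<le> norm (e p)"
      using norm_tls_gram_ge[of "data_matrix p" "data_rhs p" "x - tls_map p"]
      by (simp add: \<mu>_def norm_minus_commute)
    moreover have "\<mu> p > 0"
      using * tls_sv(1)[of "data_matrix p" "data_rhs p"] by (simp add: \<mu>_def power_strict_mono)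
    ultimately show "norm (tls_map p - x) \<le> norm (e p) / \<mu> p" by (simp add: field_simps)
  qed
  then have "((\<lambda>p. tls_map p - x) \<longlongrightarrow> 0) (at p0)"
    using lim by (rule Lim_null_comparison)
  then show ?thesis by (simp add: isCont_def LIM_zero_iff at_p0)
qed

text \<open>The next two identities are exact; they hold because both the base point and the perturbed
  point satisfy the eigenvector equations.\<close>

lemma tls_sv_increment:
  assumes "tls_eqs (data_matrix p) (data_rhs p) (tls_map p)"
  shows "((sv p)\<^sup>2 - (tls_sv A b)\<^sup>2) * (1 + x \<bullet> tls_map p) =
    (A *v x - b) \<bullet> (dA p *v tls_map p - db p) + (dA p *v x - db p) \<bullet> res p"
proof -
  let ?A = "data_matrix p" and ?b = "data_rhs p" and ?x = "tls_map p" and ?r = "A *v x - b"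
  \<comment> \<open>The perturbed equations are paired with \<open>(x, -1)\<close>, and below the
    original ones with \<open>(tls_map p, -1)\<close>; both eigenvalues thus get the same
    factor.\<close>
  have "x \<bullet> (transpose ?A *v res p) - ?b \<bullet> res p = (sv p)\<^sup>2 * (1 + x \<bullet> ?x)"
    using assms by (simp add: tls_eqs_def algebra_simps)
  then have 1: "(?A *v x - ?b) \<bullet> res p = (sv p)\<^sup>2 * (1 + x \<bullet> ?x)"
    by (simp add: inner_matrix_transpose inner_diff_left)
  have "?x \<bullet> (transpose A *v ?r) - b \<bullet> ?r = (tls_sv A b)\<^sup>2 * (1 + x \<bullet> ?x)"
    using eqs by (simp add: tls_eqs_def algebra_simps inner_commute)
  then have 2: "(A *v ?x - b) \<bullet> ?r = (tls_sv A b)\<^sup>2 * (1 + x \<bullet> ?x)"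
    by (simp add: inner_matrix_transpose inner_diff_left)
  have "dA p *v x - db p = (?A *v x - ?b) - ?r" "dA p *v ?x - db p = res p - (A *v ?x - b)"
    by (simp_all add: matrix_vector_mult_diff_rdistrib)
  then have "?r \<bullet> (dA p *v ?x - db p) + (dA p *v x - db p) \<bullet> res p =
      (?A *v x - ?b) \<bullet> res p - (A *v ?x - b) \<bullet> ?r"
    by (simp only: inner_diff_left[of "?A *v x - ?b"] inner_diff_right[of ?r "res p"])
      (simp add: inner_commute)
  then show ?thesis unfolding 1 2 by (simp add: algebra_simps)
qed

lemma tls_map_increment:
  assumes "tls_eqs (data_matrix p) (data_rhs p) (tls_map p)"
  shows "tls_map p = x + matrix_inv (tls_gram A b) *v
    (((sv p)\<^sup>2 - (tls_sv A b)\<^sup>2) *\<^sub>R tls_map p - transpose (dA p) *v res p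
      - transpose A *v (dA p *v tls_map p - db p))"
proof -
  let ?A = "data_matrix p" and ?b = "data_rhs p" and ?x = "tls_map p"
  have 1: "transpose (dA p) *v res p = (sv p)\<^sup>2 *\<^sub>R ?x - transpose A *v res p"
  proof -
    have "transpose (dA p) = transpose ?A - transpose A"
      by (simp add: transpose_def vec_eq_iff)
    then show ?thesis
      using assms by (simp add: matrix_vector_mult_diff_rdistrib tls_eqs_def)
  qed
  have 2: "dA p *v ?x - db p = res p - (A *v ?x - b)"
    by (simp add: matrix_vector_mult_diff_rdistrib)
  \<comment> \<open>By \<open>1\<close> and \<open>2\<close> all terms with \<open>res p\<close> and
    \<open>sv p\<close> cancel.\<close>
  have "((sv p)\<^sup>2 - (tls_sv A b)\<^sup>2) *\<^sub>R ?x - transpose (dA p) *v res p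
      - transpose A *v (dA p *v ?x - db p) = transpose A *v (A *v ?x - b) - (tls_sv A b)\<^sup>2 *\<^sub>R ?x"
    unfolding 1 2 matrix_vector_mult_diff_distrib[of "transpose A" "res p"]
    by (simp add: scaleR_left_diff_distrib)
  also have "\<dots> = tls_gram A b *v (?x - x)"
    using eqs by (simp add: tls_gram_mult tls_eqs_def matrix_vector_mult_diff_distrib algebra_simps)
  finally show ?thesis using matrix_inv_cancel(1)[OF inj_tls_gram[OF gap]] by simp
qed

text \<open>Every term of the increment formula has a factor that vanishes at \<open>p0\<close>,
  multiplied by something continuous, so \<open>has_derivative_vanishing\<close> applies
  throughout.\<close>

lemma has_derivative_tls_map: "(tls_map has_derivative tls_deriv A b x) (at p0)"
proof -
  interpret mv: bounded_bilinear "(*v) :: real^'n^'m \<Rightarrow> real^'n \<Rightarrow> real^'m"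
    by (rule bounded_bilinear_matrix_vector_mult)
  interpret tmv: bounded_bilinear "(*v) :: real^'m^'n \<Rightarrow> real^'m \<Rightarrow> real^'n"
    by (rule bounded_bilinear_matrix_vector_mult)
  let ?r = "A *v x - b" and ?q = "1 + x \<bullet> x"
  let ?u = "\<lambda>h. data_matrix h *v x - data_rhs h"
  have q: "?q > 0" by (simp add: add_pos_nonneg)
  have cres: "isCont res p0"
    by (intro isCont_diff isCont_mult_vec isCont_data isCont_tls_map) simp_all
  have cq: "isCont (\<lambda>p. inverse (1 + x \<bullet> tls_map p)) p0"
    using q by (intro continuous_intros isCont_tls_map) (simp add: at_p0)
  have dA: "(dA has_derivative data_matrix) (at p0)"
    using has_derivative_diff[OF bounded_linear_imp_has_derivative[OF bounded_linear_data_matrix]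
      has_derivative_const] by simp
  have db: "(db has_derivative data_rhs) (at p0)"
    using has_derivative_diff[OF bounded_linear_imp_has_derivative[OF bounded_linear_data_rhs]
      has_derivative_const] by simp
  have tdA: "((\<lambda>p. transpose (dA p)) has_derivative (\<lambda>h. transpose (data_matrix h))) (at p0)"
    by (rule bounded_linear.has_derivative[OF bounded_linear_transpose dA])
  have d1: "((\<lambda>p. transpose (dA p) *v res p) has_derivative (\<lambda>h. transpose (data_matrix h) *v ?r)) (at p0)"
    using tmv.has_derivative_vanishing[OF tdA _ cres] by (simp add: at_p0 transpose_def zero_vec_def)
  have d2: "((\<lambda>p. dA p *v tls_map p - db p) has_derivative ?u) (at p0)"
    using has_derivative_diff[OF mv.has_derivative_vanishing[OF dA _ isCont_tls_map] db]
    by (simp add: at_p0)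
  have d3: "((\<lambda>p. dA p *v x - db p) has_derivative ?u) (at p0)"
    using has_derivative_diff[OF mv.has_derivative_vanishing[OF dA _ continuous_const] db]
    by (simp add: at_p0)
  \<comment> \<open>The right-hand side of \<open>tls_sv_increment\<close>; it vanishes at
    \<open>p0\<close>, and its divisor \<open>1 + x \<bullet> tls_map p\<close> tends to
    \<open>?q > 0\<close>.\<close>
  define N where "N p = ?r \<bullet> (dA p *v tls_map p - db p) + (dA p *v x - db p) \<bullet> res p" for p
  have N0: "N p0 = 0" by (simp add: N_def at_p0)
  have "((\<lambda>p. (dA p *v x - db p) \<bullet> res p) has_derivative (\<lambda>h. ?u h \<bullet> ?r)) (at p0)"
    using bounded_bilinear.has_derivative_vanishing[OF bounded_bilinear_inner d3 _ cres]
    by (simp add: at_p0)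
  then have "(N has_derivative (\<lambda>h. ?r \<bullet> ?u h + ?u h \<bullet> ?r)) (at p0)"
    unfolding N_def by (intro has_derivative_add has_derivative_inner_right d2)
  then have "(N has_derivative (\<lambda>h. 2 * (?r \<bullet> ?u h))) (at p0)"
    by (simp add: inner_commute)
  from bounded_bilinear.has_derivative_vanishing[OF bounded_bilinear_mult this N0 cq]
  have dl: "((\<lambda>p. N p * inverse (1 + x \<bullet> tls_map p)) has_derivative
      (\<lambda>h. 2 * (?r \<bullet> ?u h) * inverse ?q)) (at p0)" by (simp add: at_p0)
  from bounded_bilinear.has_derivative_vanishing[OF bounded_bilinear_scaleR this _ isCont_tls_map]
  have d4: "((\<lambda>p. (N p * inverse (1 + x \<bullet> tls_map p)) *\<^sub>R tls_map p) has_derivative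
      (\<lambda>h. (2 * (?r \<bullet> ?u h) * inverse ?q) *\<^sub>R x)) (at p0)" by (simp add: at_p0 N0)
  \<comment> \<open>The right-hand side of \<open>tls_map_increment\<close> with the eigenvalue
    increment replaced by its quotient; it agrees with \<open>tls_map\<close> near
    \<open>p0\<close>.\<close>
  let ?F = "\<lambda>p. x + matrix_inv (tls_gram A b) *v ((N p * inverse (1 + x \<bullet> tls_map p)) *\<^sub>R tls_map p
      - transpose (dA p) *v res p - transpose A *v (dA p *v tls_map p - db p))"
  have "(?F has_derivative (\<lambda>h. 0 + matrix_inv (tls_gram A b) *v
      ((2 * (?r \<bullet> ?u h) * inverse ?q) *\<^sub>R x - transpose (data_matrix h) *v ?r
        - transpose A *v ?u h))) (at p0)"
    by (intro has_derivative_add has_derivative_const has_derivative_diff d1 d4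
        bounded_linear.has_derivative[OF matrix_vector_mul_bounded_linear] d2)
  moreover have "(\<lambda>h. 0 + matrix_inv (tls_gram A b) *v
      ((2 * (?r \<bullet> ?u h) * inverse ?q) *\<^sub>R x - transpose (data_matrix h) *v ?r
        - transpose A *v ?u h)) = tls_deriv A b x"
    by (simp add: tls_deriv_def Let_def power2_norm_eq_inner divide_inverse fun_eq_iff)
  moreover have "\<forall>\<^sub>F p in nhds p0. ?F p = tls_map p"
  proof -
    have "((\<lambda>p. 1 + x \<bullet> tls_map p) \<longlongrightarrow> ?q) (nhds p0)"
      using isCont_tendsto_nhds[OF isCont_tls_map] unfolding at_p0
      by (intro tendsto_intros)
    then have "\<forall>\<^sub>F p in nhds p0. 0 < 1 + x \<bullet> tls_map p"
      using q by (rule order_tendstoD(1))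
    with eventually_tls_eqs show ?thesis
    proof eventually_elim
      case (elim p)
      have "N p * inverse (1 + x \<bullet> tls_map p) = (sv p)\<^sup>2 - (tls_sv A b)\<^sup>2"
        using tls_sv_increment[OF elim(1)] elim(2) by (simp add: N_def field_simps)
      then show ?case using tls_map_increment[OF elim(1)] by simp
    qed
  qed
  ultimately show ?thesis
    by (auto intro: has_derivative_transform_eventually simp: eventually_nhds_conv_at)
qed

end

section \<open>The norm of the derivative\<close>

lemma inner_stack_data: "h \<bullet> stack_data E e = data_matrix h \<bullet> E + data_rhs h \<bullet> e"
proof -
  \<comment> \<open>Stacked indices list the column first, whereas the matrix inner product sums
    over rows first; hence the swap.\<close>
  have "(\<Sum>(j, i)\<in>UNIV. data_matrix h $ i $ j * E $ i $ j) = data_matrix h \<bullet> E"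
    unfolding UNIV_Times_UNIV[symmetric] sum.cartesian_product[symmetric]
    by (subst sum.swap) (simp add: inner_vec_def)
  moreover have "h \<bullet> stack_data E e =
      (\<Sum>(j, i)\<in>UNIV. data_matrix h $ i $ j * E $ i $ j) + data_rhs h \<bullet> e"
    unfolding inner_vec_def[of h] UNIV_Plus_UNIV[symmetric]
    by (subst sum.Plus) (auto simp: stack_data_def data_matrix_def data_rhs_def inner_vec_def
        split_def intro!: sum.cong)
  ultimately show ?thesis by simp
qed

lemma norm_stack_data: "(norm (stack_data E e))\<^sup>2 = (norm E)\<^sup>2 + (norm e)\<^sup>2"
  by (simp add: power2_norm_eq_inner inner_stack_data)

text \<open>The vector \<open>g = A w - 2 (x \<bullet> w) / (1 + \<parallel>x\<parallel>\<^sup>2) r\<close> is the image of \<open>A w\<close> under the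
  reflection in the hyperplane orthogonal to \<open>r\<close>, whence \<open>\<parallel>g\<parallel> = \<parallel>A w\<parallel>\<close>.\<close>

definition tls_grad ::
  "real^'n^'m \<Rightarrow> real^'m \<Rightarrow> real^'n \<Rightarrow> real^'n \<Rightarrow> real^(('n \<times> 'm) + 'm)" where
  "tls_grad A b x w =
     (let r = A *v x - b; g = A *v w - (2 * (x \<bullet> w) / (1 + (norm x)\<^sup>2)) *\<^sub>R r
      in stack_data (- (outer r w + outer g x)) g)"

text \<open>Identifies \<open>tls_grad A b x w\<close> as the adjoint of the derivative at
  \<open>tls_gram A b *v w\<close>: by symmetry this argument cancels the inverse in
  \<open>tls_deriv\<close>.\<close>

lemma inner_tls_deriv:
  fixes A :: "real^'n^'m"
  assumes gap: "tls_sv A b < min_sv A"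
  shows "tls_deriv A b x h \<bullet> (tls_gram A b *v w) = h \<bullet> tls_grad A b x w"
proof -
  define r where "r = A *v x - b"
  define u where "u = data_matrix h *v x - data_rhs h"
  define c where "c = 2 / (1 + (norm x)\<^sup>2)"
  define g where "g = A *v w - (c * (x \<bullet> w)) *\<^sub>R r"
  define N where "N = (c * (r \<bullet> u)) *\<^sub>R x - transpose (data_matrix h) *v r - transpose A *v u"
  have "tls_deriv A b x h = matrix_inv (tls_gram A b) *v N"
    by (simp add: tls_deriv_def Let_def N_def c_def r_def u_def)
  then have "tls_deriv A b x h \<bullet> (tls_gram A b *v w) = N \<bullet> w"
    by (simp add: matrix_inv_cancel(2)[OF inj_tls_gram[OF gap]] flip: inner_tls_gram_commute)
  also have "\<dots> = c * (r \<bullet> u) * (x \<bullet> w) - r \<bullet> (data_matrix h *v w) - u \<bullet> (A *v w)"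
    unfolding N_def inner_diff_left inner_scaleR_left
    by (simp add: inner_commute[of "transpose _ *v _" w] flip: inner_matrix_transpose)
      (simp add: inner_commute)
  also have "\<dots> = - (r \<bullet> (data_matrix h *v w)) - u \<bullet> g"
    by (simp add: g_def inner_diff_right inner_commute)
  also have "\<dots> = h \<bullet> stack_data (- (outer r w + outer g x)) g"
    by (simp add: inner_stack_data inner_diff_right inner_outer u_def inner_diff_left
        inner_commute[of g])
  also have "stack_data (- (outer r w + outer g x)) g = tls_grad A b x w"
    by (simp add: tls_grad_def Let_def g_def r_def c_def)
  finally show ?thesis .
qed

text \<open>The reflection preserves \<open>|A w|\<close> and changes the sign of the component
  along r, so the two rank-one terms have inner product \<open>- l * (x \<bullet> w)^2\<close>,
  where \<open>l = (tls_sv A b)^2\<close>. This is the source of the negative term.\<close>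

lemma norm_tls_grad:
  fixes A :: "real^'n^'m"
  assumes eqs: "tls_eqs A b x"
  shows "(norm (tls_grad A b x w))\<^sup>2 =
    (1 + (norm x)\<^sup>2) * ((tls_sv A b)\<^sup>2 * (norm w)\<^sup>2 + (norm (A *v w))\<^sup>2)
    - 2 * (tls_sv A b)\<^sup>2 * (x \<bullet> w)\<^sup>2"
proof -
  define r where "r = A *v x - b"
  define q where "q = 1 + (norm x)\<^sup>2"
  define k where "k = x \<bullet> w"
  define l where "l = (tls_sv A b)\<^sup>2"
  define g where "g = A *v w - (2 * k / q) *\<^sub>R r"
  have q: "q > 0" by (simp add: q_def add_pos_nonneg)
  have rr: "r \<bullet> r = l * q"
    using tls_eqs_residual[OF eqs] by (simp add: r_def l_def q_def power2_norm_eq_inner)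
  have rA: "r \<bullet> (A *v w) = l * k"
    using eqs by (simp add: r_def k_def l_def tls_eqs_def inner_matrix_transpose inner_commute)
  have rg: "r \<bullet> g = - (l * k)"
    using q by (simp add: g_def inner_diff_right rr rA)
  have gg: "g \<bullet> g = (A *v w) \<bullet> (A *v w)"
  proof -
    have "g \<bullet> g = (A *v w) \<bullet> g - (2 * k / q) * (r \<bullet> g)"
      unfolding g_def[of] by (simp add: inner_diff_left)
    also have "(A *v w) \<bullet> g = (A *v w) \<bullet> (A *v w) - (2 * k / q) * (l * k)"
      using rA by (simp add: g_def inner_diff_right inner_commute)
    finally show ?thesis by (simp add: rg)
  qed
  have "(norm (tls_grad A b x w))\<^sup>2 = (norm (outer r w + outer g x))\<^sup>2 + (norm g)\<^sup>2"
    unfolding tls_grad_def Let_def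
    by (simp only: norm_stack_data norm_minus_cancel g_def r_def q_def k_def)
  also have "\<dots> = (r \<bullet> r) * (w \<bullet> w) + 2 * ((r \<bullet> g) * k) + (g \<bullet> g) * (x \<bullet> x) + g \<bullet> g"
    by (simp add: power2_norm_eq_inner inner_add inner_outer outer_mult k_def inner_commute mult_ac)
  also have "\<dots> = q * (l * (w \<bullet> w) + (A *v w) \<bullet> (A *v w)) - 2 * l * k\<^sup>2"
    unfolding rr rg gg by (simp add: q_def power2_norm_eq_inner[of x] power2_eq_square[of k] algebra_simps)
  finally show ?thesis by (simp add: q_def l_def k_def power2_norm_eq_inner)
qed

section \<open>Bounds for the operator norm of the derivative\<close>

context
  fixes A :: "real^'n^'m" and b :: "real^'m" and x :: "real^'n"
  assumes gap: "tls_sv A b < min_sv A" and eqs: "tls_eqs A b x"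
begin

lemma sv_gap: "(tls_sv A b)\<^sup>2 < (min_sv A)\<^sup>2"
  using gap tls_sv(1)[of A b] by (simp add: power_strict_mono)

lemma norm_tls_grad_le:
  "norm (tls_grad A b x w) \<le> sqrt (1 + (norm x)\<^sup>2) * sqrt ((min_sv A)\<^sup>2 + (tls_sv A b)\<^sup>2)
     / ((min_sv A)\<^sup>2 - (tls_sv A b)\<^sup>2) * norm (tls_gram A b *v w)"
proof -
  define l where "l = (tls_sv A b)\<^sup>2"
  define \<mu> where "\<mu> = (min_sv A)\<^sup>2 - l"
  define q where "q = 1 + (norm x)\<^sup>2"
  define y where "y = norm (tls_gram A b *v w)"
  have pos: "\<mu> > 0" "l \<ge> 0" "q > 0" using sv_gap by (auto simp: \<mu>_def l_def q_def add_pos_nonneg)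
  have w: "norm w \<le> y / \<mu>"
    using norm_tls_gram_ge[of A b w] pos by (simp add: y_def \<mu>_def l_def field_simps)
  have "w \<bullet> (tls_gram A b *v w) \<le> norm w * y"
    unfolding y_def by (rule norm_cauchy_schwarz)
  also have "\<dots> \<le> y / \<mu> * y" using w by (intro mult_right_mono) (auto simp: y_def)
  finally have "(norm (A *v w))\<^sup>2 - l * (norm w)\<^sup>2 \<le> y\<^sup>2 / \<mu>"
    by (simp add: inner_tls_gram_self l_def power2_eq_square)
  moreover have "l * (norm w)\<^sup>2 \<le> l * (y / \<mu>)\<^sup>2"
    using w pos by (intro mult_left_mono power_mono) auto
  ultimately have "l * (norm w)\<^sup>2 + (norm (A *v w))\<^sup>2 \<le> y\<^sup>2 / \<mu> + 2 * (l * (y / \<mu>)\<^sup>2)"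
    by linarith
  \<comment> \<open>The two contributions add up because
    \<open>\<mu> + 2 * l = (min_sv A)^2 + l\<close>.\<close>
  also have "\<dots> = ((min_sv A)\<^sup>2 + l) * (y / \<mu>)\<^sup>2"
  proof -
    have "(min_sv A)\<^sup>2 = \<mu> + l" by (simp add: \<mu>_def)
    moreover have "y\<^sup>2 / \<mu> = \<mu> * (y / \<mu>)\<^sup>2" using pos by (simp add: power2_eq_square)
    ultimately show ?thesis by (simp add: algebra_simps)
  qed
  finally have "q * (l * (norm w)\<^sup>2 + (norm (A *v w))\<^sup>2) \<le> q * (((min_sv A)\<^sup>2 + l) * (y / \<mu>)\<^sup>2)"
    using pos by (intro mult_left_mono) auto
  moreover have "0 \<le> 2 * l * (x \<bullet> w)\<^sup>2" using pos by simp
  ultimately have "(norm (tls_grad A b x w))\<^sup>2 \<le> q * ((min_sv A)\<^sup>2 + l) * (y / \<mu>)\<^sup>2"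
    unfolding norm_tls_grad[OF eqs] l_def[symmetric] q_def[symmetric] by simp
  then have "norm (tls_grad A b x w) \<le> sqrt (q * ((min_sv A)\<^sup>2 + l) * (y / \<mu>)\<^sup>2)"
    by (rule real_le_rsqrt)
  also have "\<dots> = sqrt q * sqrt ((min_sv A)\<^sup>2 + l) * (y / \<mu>)"
    using pos by (simp add: real_sqrt_mult y_def)
  finally show ?thesis by (simp add: q_def l_def \<mu>_def y_def)
qed

text \<open>Duality: writing the value \<open>y\<close> of the derivative as
  \<open>tls_gram A b *v w\<close> turns \<open>|y|^2\<close> into the inner product of
  \<open>h\<close> with \<open>tls_grad A b x w\<close>, and one factor \<open>|y|\<close>
  cancels.\<close>

lemma norm_tls_deriv_le:
  "norm (tls_deriv A b x h) \<le> sqrt (1 + (norm x)\<^sup>2) * sqrt ((min_sv A)\<^sup>2 + (tls_sv A b)\<^sup>2)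
     / ((min_sv A)\<^sup>2 - (tls_sv A b)\<^sup>2) * norm h" (is "_ \<le> ?\<kappa> * _")
proof -
  let ?y = "tls_deriv A b x h"
  define w where "w = matrix_inv (tls_gram A b) *v ?y"
  have w: "tls_gram A b *v w = ?y"
    unfolding w_def by (rule matrix_inv_cancel(2)[OF inj_tls_gram[OF gap]])
  have "norm ?y * norm ?y = ?y \<bullet> (tls_gram A b *v w)"
    unfolding w by (simp add: dot_square_norm power2_eq_square)
  also have "\<dots> = h \<bullet> tls_grad A b x w" by (rule inner_tls_deriv[OF gap])
  also have "\<dots> \<le> norm h * norm (tls_grad A b x w)" by (rule norm_cauchy_schwarz)
  also have "\<dots> \<le> norm h * (?\<kappa> * norm ?y)"
    using norm_tls_grad_le[of w] by (intro mult_left_mono) (auto simp only: w norm_ge_zero)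
  finally have "norm ?y * norm ?y \<le> (?\<kappa> * norm h) * norm ?y" by (simp only: mult_ac)
  moreover have "0 \<le> ?\<kappa> * norm h" using sv_gap by simp
  ultimately show ?thesis
    using mult_right_le_imp_le[of "norm ?y" "norm ?y" "?\<kappa> * norm h"]
    by (cases "?y = 0") (simp_all only: zero_less_norm_iff norm_zero not_False_eq_True)
qed

lemma onorm_tls_deriv_le:
  "onorm (tls_deriv A b x) \<le> sqrt (1 + (norm x)\<^sup>2) * sqrt ((min_sv A)\<^sup>2 + (tls_sv A b)\<^sup>2)
     / ((min_sv A)\<^sup>2 - (tls_sv A b)\<^sup>2)"
  using norm_tls_deriv_le sv_gap by (intro onorm_bound) auto

text \<open>The derivative is tested in the direction \<open>G\<close>, the adjoint at
  \<open>\<mu> w\<close> for a minimal eigenvector \<open>w\<close>, since \<open>|G|^2\<close> is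
  the inner product of the derivative at \<open>G\<close> with \<open>\<mu> w\<close>.\<close>

lemma onorm_tls_deriv_ge:
  "sqrt (1 + (norm x)\<^sup>2) / sqrt ((min_sv A)\<^sup>2 - (tls_sv A b)\<^sup>2) \<le> onorm (tls_deriv A b x)"
proof -
  define l where "l = (tls_sv A b)\<^sup>2"
  define \<mu> where "\<mu> = (min_sv A)\<^sup>2 - l"
  define q where "q = 1 + (norm x)\<^sup>2"
  define K where "K = onorm (tls_deriv A b x)"
  have pos: "\<mu> > 0" "l \<ge> 0" "q > 0" using sv_gap by (auto simp: \<mu>_def l_def q_def add_pos_nonneg)
  have bl: "bounded_linear (tls_deriv A b x)"
    using has_derivative_tls_map[OF gap eqs refl] by (rule has_derivative_bounded_linear)
  obtain w where w: "w \<noteq> 0" "w \<in> gram_eigenspace A ((min_sv A)\<^sup>2)"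
    using smallest_sing_value_attained[of A] by blast
  have Mw: "tls_gram A b *v w = \<mu> *\<^sub>R w"
    using w(2) by (simp add: tls_gram_mult gram_eigenspace_def \<mu>_def l_def scaleR_left_diff_distrib
        matrix_vector_mul_assoc)
  define G where "G = tls_grad A b x w"
  have "(x \<bullet> w)\<^sup>2 \<le> (norm x * norm w)\<^sup>2"
    using Cauchy_Schwarz_ineq2[of x w] by (metis abs_ge_zero power2_abs power_mono)
  \<comment> \<open>Enlarging \<open>|x|^2\<close> to \<open>q\<close> makes the terms with
    \<open>l\<close> cancel, as \<open>q * (2 * l + \<mu>) - 2 * l * q = q * \<mu>\<close>.\<close>
  also have "\<dots> \<le> q * (norm w)\<^sup>2" by (simp add: power_mult_distrib q_def mult_right_mono)
  finally have "2 * l * (x \<bullet> w)\<^sup>2 \<le> 2 * l * (q * (norm w)\<^sup>2)"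
    using pos by (intro mult_left_mono) auto
  moreover have "(norm G)\<^sup>2 = q * (l * (norm w)\<^sup>2 + (\<mu> + l) * (norm w)\<^sup>2) - 2 * l * (x \<bullet> w)\<^sup>2"
    unfolding G_def norm_tls_grad[OF eqs] gram_eigenspace_norm[OF w(2)]
    by (simp add: q_def l_def \<mu>_def)
  ultimately have "q * \<mu> * (norm w)\<^sup>2 \<le> (norm G)\<^sup>2" by (simp add: algebra_simps)
  then have "sqrt (q * \<mu> * (norm w)\<^sup>2) \<le> norm G" by (rule real_le_lsqrt[rotated]) simp
  then have G: "sqrt q * sqrt \<mu> * norm w \<le> norm G" by (simp add: real_sqrt_mult)
  have "0 < sqrt q * sqrt \<mu> * norm w" using pos w(1) by simp
  then have Gpos: "0 < norm G" using G by linarith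
  have "norm G * norm G = G \<bullet> tls_grad A b x w"
    by (simp add: G_def dot_square_norm power2_eq_square)
  also have "\<dots> = tls_deriv A b x G \<bullet> (\<mu> *\<^sub>R w)" by (simp add: Mw flip: inner_tls_deriv[OF gap])
  also have "\<dots> \<le> norm (tls_deriv A b x G) * norm (\<mu> *\<^sub>R w)" by (rule norm_cauchy_schwarz)
  also have "\<dots> \<le> (K * norm G) * norm (\<mu> *\<^sub>R w)"
    unfolding K_def by (intro mult_right_mono onorm[OF bl]) simp
  finally have "norm G * norm G \<le> (K * (\<mu> * norm w)) * norm G" using pos by (simp add: mult_ac)
  then have "norm G \<le> K * (\<mu> * norm w)" using Gpos by simp
  then have "sqrt q * sqrt \<mu> * norm w \<le> K * \<mu> * norm w" using G by (simp add: mult_ac)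
  then have "sqrt q * sqrt \<mu> \<le> K * \<mu>" using w(1) by simp
  also have "K * \<mu> = (K * sqrt \<mu>) * sqrt \<mu>" using pos by simp
  finally have "sqrt q \<le> K * sqrt \<mu>" using pos by simp
  then have "sqrt q / sqrt \<mu> \<le> K" using pos by (simp add: divide_le_eq)
  then show ?thesis by (simp only: q_def l_def K_def \<mu>_def)
qed

end

text \<open>The numerator is at most \<open>p + s\<close>, and \<open>d \<le> p - s\<close>; their
  product is at most \<open>p^2 - s^2\<close>. It is applied with \<open>d\<close> the square root
  in the denominator of the second lower bound.\<close>

lemma sqrt_sum_squares_div_le:
  fixes p s d :: real
  assumes s: "0 \<le> s" and d: "0 < d" and p: "s + d \<le> p"
  shows "sqrt (p\<^sup>2 + s\<^sup>2) / (p\<^sup>2 - s\<^sup>2) \<le> 1 / d"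
proof -
  have "sqrt (p\<^sup>2 + s\<^sup>2) \<le> p + s"
    using s d p by (intro real_le_lsqrt) (auto simp: power2_eq_square algebra_simps)
  then have "d * sqrt (p\<^sup>2 + s\<^sup>2) \<le> (p - s) * (p + s)"
    using s d p by (intro mult_mono) auto
  also have "\<dots> = p\<^sup>2 - s\<^sup>2" by (simp add: power2_eq_square algebra_simps)
  finally have *: "d * sqrt (p\<^sup>2 + s\<^sup>2) \<le> p\<^sup>2 - s\<^sup>2" .
  have "0 < (p - s) * (p + s)" using s d p by (intro mult_pos_pos) auto
  then have "0 < p\<^sup>2 - s\<^sup>2" by (simp add: power2_eq_square algebra_simps)
  then show ?thesis using * d by (simp add: field_simps)
qed

text \<open>Differentiability is part of the conclusion because \<open>tls_cond\<close> uses
  \<open>frechet_derivative\<close>, a choice operator that yields the derivative only where one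
  exists.\<close>

theorem theorem9:
  fixes A :: "real^'n^'m" and b :: "real^'m" and x :: "real^'n"
  assumes "CARD('n) < CARD('m)"
    and "0 < sing_value (augment A b) (CARD('n) + 1)"
    and "sing_value (augment A b) (CARD('n) + 1) < sing_value A (CARD('n))"
    and "tls_solution A b x"
  shows
    "let n = CARD('n);
         \<sigma> = sing_value (augment A b);
         \<sigma>h = sing_value A;
         \<kappa>_lower1 = sqrt (1 + (norm x)\<^sup>2) * sqrt ((\<sigma>h (n - 1))\<^sup>2 + (\<sigma> (n + 1))\<^sup>2)
                    / ((\<sigma>h (n - 1))\<^sup>2 - (\<sigma> (n + 1))\<^sup>2);
         \<kappa>_lower2 = sqrt (1 + (norm x)\<^sup>2) / sqrt ((\<sigma>h n)\<^sup>2 - (\<sigma> (n + 1))\<^sup>2);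
         \<kappa>_upper1 = sqrt (1 + (norm x)\<^sup>2) * sqrt ((\<sigma>h n)\<^sup>2 + (\<sigma> (n + 1))\<^sup>2)
                    / ((\<sigma>h n)\<^sup>2 - (\<sigma> (n + 1))\<^sup>2)
     in (tls_map :: real^(('n \<times> 'm) + 'm) \<Rightarrow> real^'n) differentiable (at (stack_data A b)) \<and>
        \<kappa>_lower2 \<le> tls_cond A b \<and> tls_cond A b \<le> \<kappa>_upper1 \<and>
        (2 \<le> n \<and> \<sigma>h (n - 1) \<ge> \<sigma> (n + 1) + sqrt ((\<sigma>h n)\<^sup>2 - (\<sigma> (n + 1))\<^sup>2)
           \<longrightarrow> \<kappa>_lower1 \<le> \<kappa>_lower2)"
proof -
  let ?l = "tls_sv A b" and ?m = "min_sv A" and ?p = "sing_value A (CARD('n) - 1)"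
  have gap: "?l < ?m" by fact
  have eqs: "tls_eqs A b x" by (rule tls_solution_eqs[OF gap assms(4)])
  have der: "(tls_map has_derivative tls_deriv A b x) (at (stack_data A b))"
    by (rule has_derivative_tls_map[OF gap eqs refl])
  then have cond: "tls_cond A b = onorm (tls_deriv A b x)"
    unfolding tls_cond_def by (simp flip: frechet_derivative_at)
  have "sqrt (1 + (norm x)\<^sup>2) * sqrt (?p\<^sup>2 + ?l\<^sup>2) / (?p\<^sup>2 - ?l\<^sup>2)
      \<le> sqrt (1 + (norm x)\<^sup>2) / sqrt (?m\<^sup>2 - ?l\<^sup>2)"
    if "?l + sqrt (?m\<^sup>2 - ?l\<^sup>2) \<le> ?p"
  proof -
    have "sqrt (?p\<^sup>2 + ?l\<^sup>2) / (?p\<^sup>2 - ?l\<^sup>2) \<le> 1 / sqrt (?m\<^sup>2 - ?l\<^sup>2)"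
      using that sv_gap[OF gap eqs] tls_sv(1)[of A b] by (intro sqrt_sum_squares_div_le) auto
    from mult_left_mono[OF this, of "sqrt (1 + (norm x)\<^sup>2)"] show ?thesis
      by (simp add: add_nonneg_nonneg)
  qed
  then show ?thesis
    unfolding Let_def cond
    using der onorm_tls_deriv_le[OF gap eqs] onorm_tls_deriv_ge[OF gap eqs]
    by (auto simp only: differentiable_def)
qed

end
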